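(* Assume that for every $P\in\mathcal P$ the $p$-values $p_1,\dots,p_m$ are mutually independent, and that they are super-uniform under the null, i.e. $F_i(t)\le t$ for all $t\in[0,1]$ and all $i\in\{1,\dots,m\}$. Let $g_1,\dots,g_m\in\mathcal G$, let $\nu_i=\mathrm E[g_i(U)]$ with $U\sim\mathcal U[0,1]$, and let $$\widehat m_0(p_1,\dots,p_m)=\frac{1}{\min(\nu_1,\dots,\nu_m)}+\sum_{i=1}^m\frac{g_i(p_i)}{\nu_i}.$$ Then for every $P\in\mathcal P$ and every $h\in\mathcal H_0(P)$, $$\mathrm E\left(\frac{1}{\widehat m_0(p_{0,h})}\right)\le\frac1{m_0(P)},$$ where $p_{0,h}$ denotes the vector $(p_1,\dots,p_m)$ with $p_h$ replaced by $0$. In particular, the plug-in BH procedure using $\widehat m_0$ controls the FDR at level $\alpha$.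
   Context: Setting: an observation $X$ has distribution $P$ belonging to a set $\mathcal P$ of possible distributions. There are $m$ null hypotheses $H_{0,1},\dots,H_{0,m}$ on $P$; $\mathcal H_0(P)\subseteq\{1,\dots,m\}$ is the set of indices $i$ such that $H_{0,i}$ is satisfied by $P$, and $m_0=m_0(P)=|\mathcal H_0(P)|$. The $p$-values are $[0,1]$-valued random variables $p_i=p_i(X)$. Put $F_i(t)=\sup_{P\in\mathcal P:\, i\in\mathcal H_0(P)}\mathbf P_{X\sim P}(p_i(X)\le t)$, $t\in[0,1]$. $\mathcal U[0,1]$ is the uniform distribution on $[0,1]$. $\mathcal G$ is the set of all non-decreasing functions $g:[0,1]\to[0,1]$ with $\mathrm E[g(U)]>0$ for $U\sim\mathcal U[0,1]$. Plug-in BH procedure at level $\alpha\in(0,1)$ with estimator $\widehat m_0=\widehat m_0(p_1,\dots,p_m)$: let $p_{(1)}\le\dots\le p_{(m)}$ be the ordered $p$-values with corresponding null hypotheses $H_{(1)},\dots,H_{(m)}$, and $p_{(0)}:=0$; reject $H_{(1)},\dots,H_{(\hat k)}$, where $\hat k=\max\{\ell\in\{0,\dots,m\}: p_{(\ell)}\le \ell\alpha/\widehat m_0\}$. FDR is the expectation of the number of rejected true null hypotheses divided by $\max(1,\text{number of rejections})$. Controlling the FDR at level $\alpha$ means that this expectation is $\le\alpha$ for every $P\in\mathcal P$. *)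

theory Defs
  imports "HOL-Probability.Probability"
begin

text \<open>
  The observation takes values in a measurable space, a distribution is a probability measure on
  it, and the hypothesis \<open>H\<^sub>0\<^sub>,\<^sub>i\<close> is the set \<open>H i\<close> of the distributions that satisfy it. Vectors
  indexed by \<open>1, \<dots>, m\<close> are functions on \<open>nat\<close> whose other values are never used.
\<close>

definition true_nulls :: "nat \<Rightarrow> (nat \<Rightarrow> 'x measure set) \<Rightarrow> 'x measure \<Rightarrow> nat set" where
  "true_nulls m H P = {i \<in> {1..m}. P \<in> H i}"

text \<open>
  The supremum is taken in \<open>ennreal\<close>, so that it is \<open>0\<close> if no distribution satisfies the
  \<open>i\<close>-th hypothesis.
\<close>

definition null_cdf ::
    "'x measure set \<Rightarrow> nat \<Rightarrow> (nat \<Rightarrow> 'x measure set) \<Rightarrow> (nat \<Rightarrow> 'x \<Rightarrow> real) \<Rightarrow> nat \<Rightarrow> real \<Rightarrow> ennreal"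
  where
  "null_cdf \<P> m H p i t =
     (SUP P \<in> {P \<in> \<P>. i \<in> true_nulls m H P}. emeasure P {x \<in> space P. p i x \<le> t})"

text \<open>
  The uniform distribution lives on the space \<open>{0..1}\<close> and not on the whole real line: the
  functions below are only meaningful on the unit interval, and this way their values elsewhere
  affect neither measurability nor the mean.
\<close>

definition uniform01 :: "real measure" where
  "uniform01 = uniform_measure (restrict_space lborel {0..1}) {0..1}"

definition uniform_mean :: "(real \<Rightarrow> real) \<Rightarrow> real" where
  "uniform_mean g = (\<integral>u. g u \<partial>uniform01)"

definition \<G> :: "(real \<Rightarrow> real) set" where
  "\<G> = {g. g \<in> {0..1} \<rightarrow> {0..1} \<and> mono_on {0..1} g \<and> 0 < uniform_mean g}"

definition m0_hat :: "nat \<Rightarrow> (nat \<Rightarrow> real \<Rightarrow> real) \<Rightarrow> (nat \<Rightarrow> real) \<Rightarrow> real" where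
  "m0_hat m g q =
     1 / Min ((\<lambda>i. uniform_mean (g i)) ` {1..m}) + (\<Sum>i=1..m. g i (q i) / uniform_mean (g i))"

text \<open>
  \<open>pval_order m q\<close> lists the indices by increasing \<open>p\<close>-value. Ties are broken by index, which is
  immaterial for a positive estimate of \<open>m\<^sub>0\<close>: if the \<open>l\<close>-th and the next ordered \<open>p\<close>-values
  coincide, then \<open>l\<close> is not the maximum in \<open>k_hat\<close>.
\<close>

definition pval_order :: "nat \<Rightarrow> (nat \<Rightarrow> real) \<Rightarrow> nat list" where
  "pval_order m q = sort_key q [1..<Suc m]"

definition ordered_pval :: "nat \<Rightarrow> (nat \<Rightarrow> real) \<Rightarrow> nat \<Rightarrow> real" where
  "ordered_pval m q l = (if l = 0 then 0 else q (pval_order m q ! (l - 1)))"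

definition k_hat :: "nat \<Rightarrow> real \<Rightarrow> ((nat \<Rightarrow> real) \<Rightarrow> real) \<Rightarrow> (nat \<Rightarrow> real) \<Rightarrow> nat" where
  "k_hat m \<alpha> m0h q = Max {l \<in> {0..m}. ordered_pval m q l \<le> real l * \<alpha> / m0h q}"

definition plugin_BH :: "nat \<Rightarrow> real \<Rightarrow> ((nat \<Rightarrow> real) \<Rightarrow> real) \<Rightarrow> (nat \<Rightarrow> real) \<Rightarrow> nat set" where
  "plugin_BH m \<alpha> m0h q = set (take (k_hat m \<alpha> m0h q) (pval_order m q))"

definition FDR ::
    "nat \<Rightarrow> (nat \<Rightarrow> 'x measure set) \<Rightarrow> (nat \<Rightarrow> 'x \<Rightarrow> real) \<Rightarrow> ((nat \<Rightarrow> real) \<Rightarrow> nat set)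
      \<Rightarrow> 'x measure \<Rightarrow> real" where
  "FDR m H p R P =
     (\<integral>x. real (card (R (\<lambda>i. p i x) \<inter> true_nulls m H P)) / real (max 1 (card (R (\<lambda>i. p i x)))) \<partial>P)"

definition controls_FDR ::
    "'x measure set \<Rightarrow> nat \<Rightarrow> (nat \<Rightarrow> 'x measure set) \<Rightarrow> (nat \<Rightarrow> 'x \<Rightarrow> real)
      \<Rightarrow> ((nat \<Rightarrow> real) \<Rightarrow> nat set) \<Rightarrow> real \<Rightarrow> bool" where
  "controls_FDR \<P> m H p R \<alpha> \<longleftrightarrow> (\<forall>P\<in>\<P>. FDR m H p R P \<le> \<alpha>)"

end

theory Submission
  imports Defs "HOL-Real_Asymp.Real_Asymp"
begin

text \<open>
  Let \<open>\<nu>\<close> be the least of the means. The variables \<open>Z\<^sub>i = \<nu> g\<^sub>i(p\<^sub>i) / \<nu>\<^sub>i\<close> for the true nulls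
  \<open>i \<noteq> h\<close> are independent, lie in \<open>[0, 1]\<close> and have mean at least \<open>\<nu>\<close>, because \<open>p\<^sub>i\<close>
  stochastically dominates a uniform variable. As \<open>1 / m0_hat \<le> \<nu> / (1 + \<Sum> Z\<^sub>i)\<close>, convexity reduces
  the bound to Bernoulli variables, for which it reads
  \<open>\<nu> \<cdot> (1 - (1 - \<nu>) ^ m\<^sub>0) / (\<nu> m\<^sub>0) \<le> 1 / m\<^sub>0\<close>. For the FDR, fix all \<open>p\<close>-values except that of
  a true null \<open>h\<close>. Since the estimate is nondecreasing, a rejection of \<open>h\<close> implies \<open>p\<^sub>h \<le> c k\<close>,
  where \<open>c\<close> is \<open>\<alpha>\<close> over the estimate at \<open>p\<^sub>h = 0\<close> and the number \<open>k\<close> of rejections is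
  nonincreasing in \<open>p\<^sub>h\<close>; hence \<open>1 / k\<close> integrates over this event to at most \<open>c\<close>.
\<close>

section \<open>Super-uniform variables\<close>

lemma uniform01_eq: "uniform01 = restrict_space lborel {0..1}"
proof (rule measure_eqI)
  fix A assume "A \<in> sets uniform01"
  then have A: "A \<in> sets (restrict_space lborel {0..1::real})"
    by (simp add: uniform01_def)
  then have "A \<subseteq> {0..1}"
    by (auto simp: sets_restrict_space)
  then have "{0..1} \<inter> A = A"
    by auto
  moreover have "emeasure (restrict_space lborel {0..1::real}) {0..1} = 1"
    by (subst emeasure_restrict_space) auto
  ultimately show "emeasure uniform01 A = emeasure (restrict_space lborel {0..1}) A"
    using A unfolding uniform01_def
    by (subst emeasure_uniform_measure) (auto simp: divide_ennreal_def sets_restrict_space)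
qed (simp add: uniform01_def)

lemma prob_space_uniform01: "prob_space uniform01"
  by (rule prob_spaceI) (simp add: uniform01_eq space_restrict_space emeasure_restrict_space)

text \<open>Fubini, applied to \<open>f x\<close> written as the length of \<open>{0..<f x}\<close>.
  Comparing means thereby reduces to comparing the tails \<open>y < f x\<close>.\<close>

lemma nn_integral_layer_cake:
  fixes f :: "'a \<Rightarrow> real"
  assumes "sigma_finite_measure M" and [measurable]: "f \<in> borel_measurable M"
    and nonneg: "\<And>x. x \<in> space M \<Longrightarrow> 0 \<le> f x"
  shows "(\<integral>\<^sup>+x. ennreal (f x) \<partial>M) = (\<integral>\<^sup>+y. indicator {0..} y * emeasure M {x \<in> space M. y < f x} \<partial>lborel)"
proof -
  interpret sigma_finite_measure M by fact
  interpret pair_sigma_finite lborel M ..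
  have "(\<integral>\<^sup>+x. ennreal (f x) \<partial>M) = (\<integral>\<^sup>+x. (\<integral>\<^sup>+y. indicator {0..} y * indicator {y. y < f x} y \<partial>lborel) \<partial>M)"
  proof (rule nn_integral_cong)
    fix x assume x: "x \<in> space M"
    have "(\<integral>\<^sup>+y. indicator {0..} y * indicator {y. y < f x} y \<partial>lborel) = (\<integral>\<^sup>+y. indicator {0..<f x} y \<partial>lborel)"
      by (intro nn_integral_cong) (auto simp: indicator_def)
    also have "\<dots> = ennreal (f x)"
      using nonneg[OF x] by simp
    finally show "ennreal (f x) = (\<integral>\<^sup>+y. indicator {0..} y * indicator {y. y < f x} y \<partial>lborel)" ..
  qed
  also have "\<dots> = (\<integral>\<^sup>+y. (\<integral>\<^sup>+x. indicator {0..} y * indicator {y. y < f x} y \<partial>M) \<partial>lborel)"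
    by (rule Fubini') (simp add: split_beta')
  also have "\<dots> = (\<integral>\<^sup>+y. indicator {0..} y * emeasure M {x \<in> space M. y < f x} \<partial>lborel)"
  proof (rule nn_integral_cong)
    fix y :: real
    have "(\<integral>\<^sup>+x. indicator {0..} y * indicator {y. y < f x} y \<partial>M)
        = indicator {0..} y * (\<integral>\<^sup>+x. indicator {x \<in> space M. y < f x} x \<partial>M)"
      by (subst nn_integral_cmult[symmetric]) (auto intro!: nn_integral_cong simp: indicator_def)
    then show "(\<integral>\<^sup>+x. indicator {0..} y * indicator {y. y < f x} y \<partial>M)
        = indicator {0..} y * emeasure M {x \<in> space M. y < f x}"
      by simp
  qed
  finally show ?thesis .
qed

text \<open>A sublevel set of a monotone function on the unit interval is an initial segment, so
  super-uniformity makes small values of \<open>f (X x)\<close> no more likely than small values of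
  \<open>f\<close> at a uniform variable. The layer-cake formula integrates this comparison of
  tails.\<close>

lemma uniform_mean_le_expectation:
  fixes f :: "real \<Rightarrow> real"
  assumes "prob_space M" and [measurable]: "X \<in> borel_measurable M"
    and X: "\<And>x. x \<in> space M \<Longrightarrow> X x \<in> {0..1}"
    and super: "\<And>t. 0 \<le> t \<Longrightarrow> emeasure M {x \<in> space M. X x \<le> t} \<le> ennreal t"
    and "mono f" and f: "\<And>u. f u \<in> {0..1}"
  shows "uniform_mean f \<le> (\<integral>x. f (X x) \<partial>M)"
proof -
  interpret prob_space M by fact
  interpret U: prob_space uniform01 by (rule prob_space_uniform01)
  have [measurable]: "f \<in> borel_measurable borel"
    using \<open>mono f\<close> by (rule borel_measurable_mono)
  have [measurable]: "f \<in> borel_measurable uniform01"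
    unfolding uniform01_eq by (rule measurable_restrict_space1) simp
  have space_U: "space uniform01 = {0..1}"
    by (simp add: uniform01_eq space_restrict_space)
  have "(\<integral>\<^sup>+u. ennreal (f u) \<partial>uniform01) \<le> (\<integral>\<^sup>+x. ennreal (f (X x)) \<partial>M)"
  proof -
    have "emeasure uniform01 {u \<in> space uniform01. y < f u} \<le> emeasure M {x \<in> space M. y < f (X x)}" for y
    proof -
      let ?L = "{u \<in> {0..1}. f u \<le> y}"
      have "measure M {x \<in> space M. f (X x) \<le> y} \<le> measure uniform01 ?L"
      proof (cases "?L = {}")
        case True
        then have "{x \<in> space M. f (X x) \<le> y} = {}"
          using X by auto
        then show ?thesis
          by (simp only: measure_empty measure_nonneg)
      next
        case False
        \<comment> \<open>The segment may or may not contain its right end \<open>t\<close>. The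
          event for \<open>X\<close> is enlarged to \<open>X x \<le> t\<close>, of probability at
          most \<open>t\<close>, and the uniform one shrunk to \<open>{0..<t}\<close>, of mass
          exactly \<open>t\<close>.\<close>
        define t where "t = Sup ?L"
        have bdd: "bdd_above ?L" by (rule bdd_aboveI[of _ 1]) auto
        have le_t: "u \<le> t" if "u \<in> ?L" for u
          unfolding t_def using that bdd by (rule cSup_upper)
        have "t \<le> 1"
          unfolding t_def using False by (intro cSup_least) auto
        have "0 \<le> t"
          using False le_t by force
        have sub: "{0..<t} \<subseteq> ?L"
        proof
          fix u assume u: "u \<in> {0..<t}"
          then obtain v where "v \<in> ?L" "u < v"
            using less_cSup_iff[OF False bdd, of u] by (auto simp: t_def)
          then show "u \<in> ?L"
            using u monoD[OF \<open>mono f\<close>, of u v] by auto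
        qed
        have "emeasure M {x \<in> space M. f (X x) \<le> y} \<le> emeasure M {x \<in> space M. X x \<le> t}"
          by (rule emeasure_mono) (use X le_t in auto)
        also have "\<dots> \<le> ennreal t"
          using \<open>0 \<le> t\<close> by (rule super)
        also have "\<dots> = emeasure uniform01 {0..<t}"
          unfolding uniform01_eq using \<open>t \<le> 1\<close> \<open>0 \<le> t\<close>
          by (subst emeasure_restrict_space) auto
        also have "\<dots> \<le> emeasure uniform01 ?L"
          by (rule emeasure_mono[OF sub]) (unfold space_U[symmetric], measurable)
        finally show ?thesis
          by (simp add: emeasure_eq_measure U.emeasure_eq_measure)
      qed
      moreover have "measure M {x \<in> space M. y < f (X x)} = 1 - measure M {x \<in> space M. f (X x) \<le> y}"
        by (subst prob_compl[symmetric]) (auto intro!: arg_cong[where f = "measure M"])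
      moreover have "measure uniform01 {u \<in> space uniform01. y < f u} = 1 - measure uniform01 {u \<in> space uniform01. f u \<le> y}"
        by (subst U.prob_compl[symmetric]) (auto intro!: arg_cong[where f = "measure uniform01"])
      ultimately show ?thesis
        by (simp add: emeasure_eq_measure U.emeasure_eq_measure space_U)
    qed
    then show ?thesis
      using f by (subst (1 2) nn_integral_layer_cake)
        (auto intro!: nn_integral_mono mult_left_mono sigma_finite_measure_axioms U.sigma_finite_measure_axioms)
  qed
  moreover have "(\<integral>\<^sup>+u. ennreal (f u) \<partial>uniform01) = ennreal (uniform_mean f)"
    unfolding uniform_mean_def using f
    by (intro nn_integral_eq_integral U.integrable_const_bound[where B = 1]) auto
  moreover have "(\<integral>\<^sup>+x. ennreal (f (X x)) \<partial>M) = ennreal (\<integral>x. f (X x) \<partial>M)"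
    using f by (intro nn_integral_eq_integral integrable_const_bound[where B = 1]) auto
  moreover have "0 \<le> (\<integral>x. f (X x) \<partial>M)"
    using f by (intro integral_nonneg_AE) auto
  ultimately show ?thesis
    by simp
qed

section \<open>Inverse moment of one plus a sum of independent variables\<close>

lemma exp_neg_mult_le:
  fixes t z :: real
  assumes "z \<in> {0..1}"
  shows "exp (- t * z) \<le> 1 - (1 - exp (- t)) * z"
  \<comment> \<open>The point \<open>- t * z\<close> is the convex combination of \<open>0\<close>
    and \<open>- t\<close> with weight \<open>z\<close>, and the right-hand side is the chord
    there.\<close>
  using convex_onD[OF exp_convex, of z 0 "- t"] assms by (simp add: algebra_simps)

text \<open>
  The sum is decoupled by \<open>1 / (1 + s) = \<integral>\<^sub>0\<^sup>\<infinity> exp (- t) exp (- t s) dt\<close>, after which each factor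
  \<open>exp (- t z)\<close> is bounded by its chord on \<open>[0, 1]\<close>.
\<close>

lemma (in prob_space) expectation_inverse_one_plus_sum_le:
  fixes Z :: "'i \<Rightarrow> 'a \<Rightarrow> real"
  assumes fin: "finite I" and indep: "indep_vars (\<lambda>_. borel) Z I"
    and Z: "\<And>i x. i \<in> I \<Longrightarrow> x \<in> space M \<Longrightarrow> Z i x \<in> {0..1}"
    and c: "0 < c" "c \<le> 1" and mean: "\<And>i. i \<in> I \<Longrightarrow> c \<le> expectation (Z i)"
  shows "expectation (\<lambda>x. 1 / (1 + (\<Sum>i\<in>I. Z i x))) \<le> 1 / (c * (real (card I) + 1))"
proof -
  interpret pair_sigma_finite lborel M ..
  define n where "n = card I"
  \<comment> \<open>For \<open>i \<in> I\<close> the truncation at \<open>0\<close> is inactive on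
    \<open>space M\<close>; it keeps \<open>Y\<close> nonnegative elsewhere, where \<open>Z\<close>
    is unconstrained.\<close>
  define Y where "Y t i x = max 0 (1 - (1 - exp (- t)) * Z i x)" for t i x
  have Y_nonneg: "0 \<le> Y t i x" for t i x
    by (simp add: Y_def)
  have Zm[measurable]: "random_variable borel (Z i)" if "i \<in> I" for i
    using indep that by (auto simp: indep_vars_def)
  have int_Z: "integrable M (Z i)" if "i \<in> I" for i
    using Z[OF that] that by (intro integrable_const_bound[where B = 1]) auto
  have S0: "0 \<le> (\<Sum>i\<in>I. Z i x)" if "x \<in> space M" for x
    using Z that by (intro sum_nonneg) auto
  have "(\<integral>\<^sup>+x. ennreal (1 / (1 + (\<Sum>i\<in>I. Z i x))) \<partial>M)
      \<le> (\<integral>\<^sup>+x. (\<integral>\<^sup>+t. ennreal (exp (- t) * (\<Prod>i\<in>I. Y t i x)) * indicator {0..} t \<partial>lborel) \<partial>M)"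
  proof (rule nn_integral_mono)
    fix x assume x: "x \<in> space M"
    define S where "S = (\<Sum>i\<in>I. Z i x)"
    have S: "0 \<le> S" using S0[OF x] by (simp add: S_def)
    have lim: "((\<lambda>t. - exp (- t * (1 + S)) / (1 + S)) \<longlongrightarrow> 0) at_top"
      using S by real_asymp
    have deriv: "((\<lambda>t. - exp (- t * (1 + S)) / (1 + S)) has_real_derivative exp (- t * (1 + S))) (at t)" for t
    proof -
      define e where "e = exp (- t * (1 + S))"
      have "((\<lambda>t. - exp (- t * (1 + S)) / (1 + S)) has_real_derivative
          - (e * (- (1 + S))) / (1 + S)) (at t)"
        using S by (auto intro!: derivative_eq_intros simp: e_def)
      also have "- (e * (- (1 + S))) / (1 + S) = e"
        unfolding mult_minus_right minus_minus using S by (intro nonzero_mult_div_cancel_right) auto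
      finally show ?thesis
        by (simp only: e_def)
    qed
    have "(\<integral>\<^sup>+t. ennreal (exp (- t * (1 + S))) * indicator {0..} t \<partial>lborel)
        = ennreal (0 - - exp (- 0 * (1 + S)) / (1 + S))"
      by (rule nn_integral_FTC_atLeast[OF _ deriv _ lim]) auto
    then have "ennreal (1 / (1 + S)) = (\<integral>\<^sup>+t. ennreal (exp (- t * (1 + S))) * indicator {0..} t \<partial>lborel)"
      by simp
    also have "\<dots> \<le> (\<integral>\<^sup>+t. ennreal (exp (- t) * (\<Prod>i\<in>I. Y t i x)) * indicator {0..} t \<partial>lborel)"
    proof (intro nn_integral_mono mult_right_mono ennreal_leI)
      fix t :: real
      have "- t * (1 + S) = - t + (\<Sum>i\<in>I. - t * Z i x)"
        unfolding S_def sum_distrib_left[symmetric] by (simp add: distrib_left)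
      then have "exp (- t * (1 + S)) = exp (- t) * (\<Prod>i\<in>I. exp (- t * Z i x))"
        by (simp only: exp_add exp_sum[OF fin])
      also have "\<dots> \<le> exp (- t) * (\<Prod>i\<in>I. Y t i x)"
        unfolding Y_def using Z[OF _ x] exp_neg_mult_le
        by (intro mult_left_mono prod_mono) (auto simp: le_max_iff_disj)
      finally show "exp (- t * (1 + S)) \<le> exp (- t) * (\<Prod>i\<in>I. Y t i x)" .
    qed simp
    finally show "ennreal (1 / (1 + (\<Sum>i\<in>I. Z i x))) \<le> \<dots>"
      by (simp add: S_def)
  qed
  also have "\<dots> = (\<integral>\<^sup>+t. (\<integral>\<^sup>+x. ennreal (exp (- t) * (\<Prod>i\<in>I. Y t i x)) * indicator {0..} t \<partial>M) \<partial>lborel)"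
  proof (rule Fubini')
    have "(\<lambda>p. Z i (snd p)) \<in> borel_measurable (lborel \<Otimes>\<^sub>M M)" if "i \<in> I" for i
      using Zm[OF that] by measurable
    then show "(\<lambda>(t, x). ennreal (exp (- t) * (\<Prod>i\<in>I. Y t i x)) * indicator {0..} t)
        \<in> borel_measurable (lborel \<Otimes>\<^sub>M M)"
      unfolding Y_def split_beta' by measurable
  qed
  \<comment> \<open>Since \<open>1 - exp (- t)\<close> is nonnegative for \<open>t \<ge> 0\<close>,
    the lower bound \<open>c\<close> on the means bounds the mean of each factor above by
    \<open>1 - c + c * exp (- t)\<close>, the Laplace transform of a Bernoulli variable with mean
    \<open>c\<close>.\<close>
  also have "\<dots> \<le> (\<integral>\<^sup>+t. ennreal (exp (- t) * (1 - c + c * exp (- t)) ^ n) * indicator {0..} t \<partial>lborel)"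
  proof (rule nn_integral_mono)
    fix t :: real
    show "(\<integral>\<^sup>+x. ennreal (exp (- t) * (\<Prod>i\<in>I. Y t i x)) * indicator {0..} t \<partial>M)
        \<le> ennreal (exp (- t) * (1 - c + c * exp (- t)) ^ n) * indicator {0..} t"
    proof (cases "0 \<le> t")
      case True
      have "indep_vars (\<lambda>_. borel) (Y t) I"
        unfolding Y_def by (rule indep_vars_compose2[OF indep]) measurable
      then have "indep_vars (\<lambda>_. borel) (\<lambda>i x. ennreal (Y t i x)) I"
        by (rule indep_vars_compose2) simp
      then have "(\<integral>\<^sup>+x. (\<Prod>i\<in>I. ennreal (Y t i x)) \<partial>M) = (\<Prod>i\<in>I. \<integral>\<^sup>+x. ennreal (Y t i x) \<partial>M)"
        by (rule indep_vars_nn_integral[OF fin]) simp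
      also have "\<dots> \<le> (\<Prod>i\<in>I. ennreal (1 - c + c * exp (- t)))"
      proof (rule prod_mono_ennreal)
        fix i assume i: "i \<in> I"
        have nonneg: "0 \<le> 1 - (1 - exp (- t)) * Z i x" if "x \<in> space M" for x
          using mult_mono[of "1 - exp (- t)" 1 "Z i x" 1] Z[OF i that] True by simp
        have "(\<integral>\<^sup>+x. ennreal (Y t i x) \<partial>M) = (\<integral>\<^sup>+x. ennreal (1 - (1 - exp (- t)) * Z i x) \<partial>M)"
          unfolding Y_def using nonneg by (intro nn_integral_cong) (simp add: max_def)
        also have "\<dots> = ennreal (\<integral>x. 1 - (1 - exp (- t)) * Z i x \<partial>M)"
          using nonneg int_Z[OF i] by (intro nn_integral_eq_integral) auto
        also have "\<dots> = ennreal (1 - (1 - exp (- t)) * expectation (Z i))"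
          using int_Z[OF i] by (simp add: prob_space)
        also have "\<dots> \<le> ennreal (1 - c + c * exp (- t))"
          using mult_left_mono[OF mean[OF i], of "1 - exp (- t)"] True
          by (intro ennreal_leI) (simp add: algebra_simps)
        finally show "(\<integral>\<^sup>+x. ennreal (Y t i x) \<partial>M) \<le> ennreal (1 - c + c * exp (- t))"
          by simp
      qed
      also have "\<dots> = ennreal ((1 - c + c * exp (- t)) ^ n)"
        using c by (simp add: n_def ennreal_power del: ennreal_plus)
      finally have *: "(\<integral>\<^sup>+x. (\<Prod>i\<in>I. ennreal (Y t i x)) \<partial>M) \<le> ennreal ((1 - c + c * exp (- t)) ^ n)" .
      have "(\<integral>\<^sup>+x. ennreal (exp (- t) * (\<Prod>i\<in>I. Y t i x)) \<partial>M) = (\<integral>\<^sup>+x. ennreal (exp (- t)) * (\<Prod>i\<in>I. ennreal (Y t i x)) \<partial>M)"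
        by (intro nn_integral_cong) (simp add: ennreal_mult prod_ennreal prod_nonneg Y_nonneg)
      also have "\<dots> = ennreal (exp (- t)) * (\<integral>\<^sup>+x. (\<Prod>i\<in>I. ennreal (Y t i x)) \<partial>M)"
        unfolding Y_def by (intro nn_integral_cmult) measurable
      also have "\<dots> \<le> ennreal (exp (- t)) * ennreal ((1 - c + c * exp (- t)) ^ n)"
        using * by (rule mult_left_mono) simp
      finally show ?thesis
        using True c by (simp add: ennreal_mult)
    qed simp
  qed
  \<comment> \<open>The base of the power in the antiderivative is \<open>1\<close> at
    \<open>0\<close> and tends to \<open>1 - c\<close> at infinity. The integral is therefore
    \<open>(1 - (1 - c) ^ Suc n) / (c * (real n + 1))\<close>, from which the next step drops
    \<open>(1 - c) ^ Suc n\<close>.\<close>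
  also have "\<dots> = ennreal (- ((1 - c) ^ Suc n) / (c * (real n + 1))
      - (- ((1 - c + c * exp (- 0)) ^ Suc n)) / (c * (real n + 1)))"
  proof (rule nn_integral_FTC_atLeast)
    have "((\<lambda>t::real. exp (- t)) \<longlongrightarrow> 0) at_top"
      by real_asymp
    then have "((\<lambda>t::real. - ((1 - c + c * exp (- t)) ^ Suc n) / (c * (real n + 1))) \<longlongrightarrow>
        - ((1 - c + c * 0) ^ Suc n) / (c * (real n + 1))) at_top"
      using c by (intro tendsto_intros) auto
    then show "((\<lambda>t::real. - ((1 - c + c * exp (- t)) ^ Suc n) / (c * (real n + 1))) \<longlongrightarrow>
        - ((1 - c) ^ Suc n) / (c * (real n + 1))) at_top"
      by simp
  next
    fix t :: real
    have "((\<lambda>t. 1 - c + c * exp (- t)) has_real_derivative - (c * exp (- t))) (at t)"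
      by (auto intro!: derivative_eq_intros)
    from DERIV_cdivide[OF DERIV_minus[OF DERIV_power_Suc[OF this]]]
    show "((\<lambda>t. - ((1 - c + c * exp (- t)) ^ Suc n) / (c * (real n + 1))) has_real_derivative
        exp (- t) * (1 - c + c * exp (- t)) ^ n) (at t)"
      by (rule DERIV_cong) (use c in \<open>simp add: divide_simps\<close>)
  qed (use c in auto)
  also have "\<dots> \<le> ennreal (1 / (c * (real n + 1)))"
    using c by (intro ennreal_leI) (simp add: divide_right_mono diff_divide_distrib[symmetric])
  finally have "(\<integral>\<^sup>+x. ennreal (1 / (1 + (\<Sum>i\<in>I. Z i x))) \<partial>M) \<le> ennreal (1 / (c * (real n + 1)))" .
  moreover have "(\<integral>\<^sup>+x. ennreal (1 / (1 + (\<Sum>i\<in>I. Z i x))) \<partial>M) = ennreal (expectation (\<lambda>x. 1 / (1 + (\<Sum>i\<in>I. Z i x))))"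
    using S0
    by (intro nn_integral_eq_integral integrable_const_bound[where B = 1] AE_I2) (auto simp: divide_le_eq_1)
  ultimately show ?thesis
    using c by (simp add: n_def)
qed

text \<open>
  The event \<open>u \<le> c * k u\<close> is contained in \<open>u \<le> c * l\<close>, where \<open>l\<close> is the least positive value of
  \<open>k\<close> on it.
\<close>

lemma nn_integral_self_consistent_le:
  fixes N :: "real measure" and k :: "real \<Rightarrow> nat"
  assumes "prob_space N" and sets_N: "sets N = sets borel"
    and super: "\<And>t. 0 \<le> t \<Longrightarrow> emeasure N {..t} \<le> ennreal t"
    and "antimono k" and c: "0 \<le> c"
  shows "(\<integral>\<^sup>+u. ennreal (if u \<le> c * real (k u) then 1 / real (k u) else 0) \<partial>N) \<le> ennreal c"
proof -
  \<comment> \<open>Points with \<open>k u = 0\<close> contribute nothing, as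
    \<open>1 / 0 = 0\<close>, and are left out so that the least value of \<open>k\<close> on
    \<open>D\<close> is positive.\<close>
  define D where "D = {u. u \<le> c * real (k u) \<and> 0 < k u}"
  show ?thesis
  proof (cases "D = {}")
    case True
    then have "(if u \<le> c * real (k u) then 1 / real (k u) else 0) = 0" for u
      by (auto simp: D_def)
    then show ?thesis by simp
  next
    case False
    define l where "l = (LEAST l. l \<in> k ` D)"
    have "l \<in> k ` D"
      unfolding l_def using False by (metis LeastI image_eqI ex_in_conv)
    then obtain v where v: "v \<in> D" "k v = l" by auto
    have l_le: "l \<le> k u" if "u \<in> D" for u
      unfolding l_def using that by (intro Least_le) auto
    have "0 < l" using v by (auto simp: D_def)
    \<comment> \<open>Left of \<open>v\<close>, \<open>u \<le> v \<le> c * real l\<close>. Right of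
      \<open>v\<close>, \<open>k u \<le> l\<close> by monotonicity and \<open>l \<le> k u\<close> by
      minimality, so the defining inequality of \<open>D\<close> reads
      \<open>u \<le> c * real l\<close>.\<close>
    have "u \<le> c * real l" if "u \<in> D" for u
    proof (cases "u \<le> v")
      case True
      then show ?thesis using v by (auto simp: D_def)
    next
      case False
      then have "k u \<le> l"
        using antimonoD[OF \<open>antimono k\<close>, of v u] v by simp
      then have "k u = l" using l_le[OF that] by simp
      then show ?thesis using that by (auto simp: D_def)
    qed
    then have "ennreal (if u \<le> c * real (k u) then 1 / real (k u) else 0)
        \<le> ennreal (1 / real l) * indicator {..c * real l} u" for u
      using l_le[of u] \<open>0 < l\<close>
      by (cases "u \<in> D") (auto simp: D_def frac_le intro!: ennreal_leI)
    then have "(\<integral>\<^sup>+u. ennreal (if u \<le> c * real (k u) then 1 / real (k u) else 0) \<partial>N)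
        \<le> (\<integral>\<^sup>+u. ennreal (1 / real l) * indicator {..c * real l} u \<partial>N)"
      by (rule nn_integral_mono)
    also have "\<dots> = ennreal (1 / real l) * emeasure N {..c * real l}"
      by (rule nn_integral_cmult_indicator) (simp add: sets_N)
    also have "\<dots> \<le> ennreal (1 / real l) * ennreal (c * real l)"
      using c by (intro mult_left_mono super) auto
    also have "\<dots> = ennreal c"
      using c \<open>0 < l\<close> by (simp add: ennreal_mult[symmetric])
    finally show ?thesis .
  qed
qed

section \<open>Order statistics and the number of rejections\<close>

lemma set_pval_order [simp]: "set (pval_order m q) = {1..m}"
  and length_pval_order [simp]: "length (pval_order m q) = m"
  and distinct_pval_order [simp]: "distinct (pval_order m q)"
  by (auto simp: pval_order_def)

lemma pval_order_mono:
  assumes "i \<le> j" "j < m"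
  shows "q (pval_order m q ! i) \<le> q (pval_order m q ! j)"
  using sorted_nth_mono[of "map q (pval_order m q)" i j] assms
  by (simp add: pval_order_def del: upt_Suc)

text \<open>Counting the p-values below a threshold replaces the sorted list: counts do not see how
  ties are broken and respond monotonically to changes of the p-values.\<close>

lemma ordered_pval_le_iff:
  assumes "1 \<le> l" "l \<le> m"
  shows "ordered_pval m q l \<le> t \<longleftrightarrow> l \<le> card {i \<in> {1..m}. q i \<le> t}"
proof
  let ?xs = "pval_order m q"
  assume le: "ordered_pval m q l \<le> t"
  have "set (take l ?xs) \<subseteq> {i \<in> {1..m}. q i \<le> t}"
  proof
    fix i assume i: "i \<in> set (take l ?xs)"
    then obtain j where j: "j < l" "i = ?xs ! j"
      using assms by (auto simp: in_set_conv_nth)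
    then have "q i \<le> ordered_pval m q l"
      using pval_order_mono[of j "l - 1" m q] assms by (simp add: ordered_pval_def)
    then show "i \<in> {i \<in> {1..m}. q i \<le> t}"
      using le in_set_takeD[OF i] by simp
  qed
  then have "card (set (take l ?xs)) \<le> card {i \<in> {1..m}. q i \<le> t}"
    by (intro card_mono) auto
  then show "l \<le> card {i \<in> {1..m}. q i \<le> t}"
    using assms by (simp add: distinct_card)
next
  let ?xs = "pval_order m q"
  assume le: "l \<le> card {i \<in> {1..m}. q i \<le> t}"
  show "ordered_pval m q l \<le> t"
  proof (rule ccontr)
    assume gt: "\<not> ordered_pval m q l \<le> t"
    \<comment> \<open>List positions start at \<open>0\<close>, so the \<open>l\<close>-th ordered
      p-value sits at \<open>l - 1\<close>. If it exceeds \<open>t\<close>, so do all later entries,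
      and only \<open>l - 1\<close> candidates remain.\<close>
    have "{i \<in> {1..m}. q i \<le> t} \<subseteq> set (take (l - 1) ?xs)"
    proof
      fix i assume i: "i \<in> {i \<in> {1..m}. q i \<le> t}"
      then have "i \<in> set ?xs" by simp
      then obtain j where j: "j < m" "i = ?xs ! j"
        by (metis in_set_conv_nth length_pval_order)
      have "j < l - 1"
      proof (rule ccontr)
        assume "\<not> j < l - 1"
        then have "ordered_pval m q l \<le> q i"
          using pval_order_mono[of "l - 1" j m q] j assms by (simp add: ordered_pval_def)
        then show False using i gt by simp
      qed
      then show "i \<in> set (take (l - 1) ?xs)"
        using j by (auto simp: in_set_conv_nth)
    qed
    then have "card {i \<in> {1..m}. q i \<le> t} \<le> card (set (take (l - 1) ?xs))"
      by (intro card_mono) auto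
    also have "\<dots> = l - 1"
      using assms by (simp add: distinct_card)
    finally show False using le assms by simp
  qed
qed

text \<open>For \<open>l = 0\<close> both conditions hold, as the threshold and
  \<open>ordered_pval m q 0\<close> are \<open>0\<close>; the other \<open>l\<close> are covered by
  counting.\<close>

lemma k_hat_eq_Max:
  "k_hat m \<alpha> m0h q = Max {l. l \<le> m \<and> l \<le> card {i \<in> {1..m}. q i \<le> real l * \<alpha> / m0h q}}"
proof -
  have "ordered_pval m q l \<le> real l * \<alpha> / m0h q \<longleftrightarrow> l \<le> card {i \<in> {1..m}. q i \<le> real l * \<alpha> / m0h q}"
    if "l \<le> m" for l
  proof (cases "l = 0")
    case False
    then show ?thesis using that by (intro ordered_pval_le_iff) auto
  qed (simp add: ordered_pval_def)
  then show ?thesis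
    by (auto simp: k_hat_def intro!: arg_cong[where f = Max])
qed

lemma k_hat_le: "k_hat m \<alpha> m0h q \<le> m"
  and k_hat_le_card:
    "k_hat m \<alpha> m0h q \<le> card {i \<in> {1..m}. q i \<le> real (k_hat m \<alpha> m0h q) * \<alpha> / m0h q}"
proof -
  have "k_hat m \<alpha> m0h q \<in> {l. l \<le> m \<and> l \<le> card {i \<in> {1..m}. q i \<le> real l * \<alpha> / m0h q}}"
    unfolding k_hat_eq_Max by (rule Max_in) auto
  then show "k_hat m \<alpha> m0h q \<le> m"
    and "k_hat m \<alpha> m0h q \<le> card {i \<in> {1..m}. q i \<le> real (k_hat m \<alpha> m0h q) * \<alpha> / m0h q}"
    by auto
qed

lemma le_k_hat:
  assumes "l \<le> m" "l \<le> card {i \<in> {1..m}. q i \<le> real l * \<alpha> / m0h q}"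
  shows "l \<le> k_hat m \<alpha> m0h q"
  unfolding k_hat_eq_Max using assms by (intro Max_ge) auto

text \<open>Smaller p-values and a smaller positive estimate, hence larger thresholds, let the
  maximum for \<open>q'\<close> pass the counting test at \<open>q\<close> as well.\<close>

lemma k_hat_antimono:
  assumes le: "\<And>i. i \<in> {1..m} \<Longrightarrow> q i \<le> q' i" and "0 < m0h q" "m0h q \<le> m0h q'" "0 \<le> \<alpha>"
  shows "k_hat m \<alpha> m0h q' \<le> k_hat m \<alpha> m0h q"
proof (rule le_k_hat)
  let ?k = "k_hat m \<alpha> m0h q'"
  have "real ?k * \<alpha> / m0h q' \<le> real ?k * \<alpha> / m0h q"
    using assms by (intro divide_left_mono) auto
  then have "{i \<in> {1..m}. q' i \<le> real ?k * \<alpha> / m0h q'} \<subseteq> {i \<in> {1..m}. q i \<le> real ?k * \<alpha> / m0h q}"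
    using le by force
  then show "?k \<le> card {i \<in> {1..m}. q i \<le> real ?k * \<alpha> / m0h q}"
    by (intro order_trans[OF k_hat_le_card] card_mono) auto
qed (rule k_hat_le)

lemma k_hat_cong:
  assumes "\<And>i. i \<in> {1..m} \<Longrightarrow> q i = q' i" "m0h q = m0h' q'"
  shows "k_hat m \<alpha> m0h q = k_hat m \<alpha> m0h' q'"
  unfolding k_hat_eq_Max using assms by (simp cong: conj_cong)

lemma plugin_BH_subset: "plugin_BH m \<alpha> m0h q \<subseteq> {1..m}"
  using set_take_subset[of "k_hat m \<alpha> m0h q" "pval_order m q"] by (simp add: plugin_BH_def)

lemma card_plugin_BH: "card (plugin_BH m \<alpha> m0h q) = k_hat m \<alpha> m0h q"
  by (simp add: plugin_BH_def distinct_card k_hat_le)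

text \<open>If more than \<open>k\<close> p-values lay below the threshold, \<open>Suc k\<close>
  would pass the test too, against maximality. The rejection set is thus cut out by a single
  threshold, and a rejection of \<open>i\<close> becomes an inequality for
  \<open>q i\<close>.\<close>

lemma plugin_BH_eq:
  assumes "0 \<le> \<alpha>" "0 < m0h q"
  shows "plugin_BH m \<alpha> m0h q = {i \<in> {1..m}. q i \<le> real (k_hat m \<alpha> m0h q) * \<alpha> / m0h q}"
proof -
  define k where "k = k_hat m \<alpha> m0h q"
  let ?S = "{i \<in> {1..m}. q i \<le> real k * \<alpha> / m0h q}"
  have "card ?S \<le> k"
  proof (rule ccontr)
    assume less: "\<not> card ?S \<le> k"
    have "card ?S \<le> card {1..m}" by (rule card_mono) auto
    then have "Suc k \<le> m" using less by simp
    moreover have "real k * \<alpha> / m0h q \<le> real (Suc k) * \<alpha> / m0h q"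
      using assms by (intro divide_right_mono mult_right_mono) auto
    then have "?S \<subseteq> {i \<in> {1..m}. q i \<le> real (Suc k) * \<alpha> / m0h q}"
      by (blast intro: order_trans)
    then have "card ?S \<le> card {i \<in> {1..m}. q i \<le> real (Suc k) * \<alpha> / m0h q}"
      by (intro card_mono) auto
    ultimately have "Suc k \<le> k_hat m \<alpha> m0h q"
      using less by (intro le_k_hat) auto
    then show False by (simp add: k_def)
  qed
  moreover have "plugin_BH m \<alpha> m0h q \<subseteq> ?S"
  proof
    fix i assume i: "i \<in> plugin_BH m \<alpha> m0h q"
    have "k \<le> m" unfolding k_def by (rule k_hat_le)
    obtain j where j: "j < k" "i = pval_order m q ! j"
      using i \<open>k \<le> m\<close> by (auto simp: plugin_BH_def in_set_conv_nth simp flip: k_def)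
    then have "q i \<le> ordered_pval m q k"
      using pval_order_mono[of j "k - 1" m q] \<open>k \<le> m\<close> by (simp add: ordered_pval_def)
    also have "\<dots> \<le> real k * \<alpha> / m0h q"
      using k_hat_le_card[of m \<alpha> m0h q] j \<open>k \<le> m\<close>
      by (subst ordered_pval_le_iff) (auto simp flip: k_def)
    finally show "i \<in> ?S" using plugin_BH_subset[of m \<alpha> m0h q] i by auto
  qed
  ultimately show ?thesis
    unfolding k_def by (intro card_seteq) (auto simp: card_plugin_BH)
qed

section \<open>Measurability of the estimate and of the number of rejections\<close>

lemma borel_measurable_m0_hat:
  assumes q: "\<And>i. i \<in> {1..m} \<Longrightarrow> (\<lambda>x. q x i) \<in> borel_measurable N"
    and g: "\<And>i. i \<in> {1..m} \<Longrightarrow> g i \<in> borel_measurable borel"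
  shows "(\<lambda>x. m0_hat m g (q x)) \<in> borel_measurable N"
proof -
  have "(\<lambda>x. g i (q x i)) \<in> borel_measurable N" if "i \<in> {1..m}" for i
    using q[OF that] g[OF that] by (rule measurable_compose)
  then have "(\<lambda>x. \<Sum>i=1..m. g i (q x i) / uniform_mean (g i)) \<in> borel_measurable N"
    by (intro borel_measurable_sum borel_measurable_divide) auto
  then show ?thesis
    unfolding m0_hat_def by (intro borel_measurable_add) auto
qed

lemma measurable_k_hat:
  assumes q: "\<And>i. i \<in> {1..m} \<Longrightarrow> (\<lambda>x. q x i) \<in> borel_measurable N"
    and m0h [measurable]: "(\<lambda>x. m0h (q x)) \<in> borel_measurable N"
  shows "(\<lambda>x. k_hat m \<alpha> m0h (q x)) \<in> N \<rightarrow>\<^sub>M count_space UNIV"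
proof -
  have card_meas: "(\<lambda>x. card {i \<in> {1..m}. q x i \<le> real l * \<alpha> / m0h (q x)}) \<in> N \<rightarrow>\<^sub>M count_space UNIV" for l
  proof (rule measurable_card)
    fix i
    show "{x \<in> space N. i \<in> {i \<in> {1..m}. q x i \<le> real l * \<alpha> / m0h (q x)}} \<in> sets N"
    proof (cases "i \<in> {1..m}")
      case True
      note q[OF True, measurable]
      have "{x \<in> space N. q x i \<le> real l * \<alpha> / m0h (q x)} \<in> sets N"
        by measurable
      moreover have "{x \<in> space N. i \<in> {i \<in> {1..m}. q x i \<le> real l * \<alpha> / m0h (q x)}}
          = {x \<in> space N. q x i \<le> real l * \<alpha> / m0h (q x)}"
        using True by blast
      ultimately show ?thesis by (simp only:)
    next
      case False
      then have "{x \<in> space N. i \<in> {i \<in> {1..m}. q x i \<le> real l * \<alpha> / m0h (q x)}} = {}"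
        by blast
      then show ?thesis by (simp only: sets.empty_sets)
    qed
  qed
  have "Measurable.pred N (\<lambda>x. l \<le> m \<and> l \<le> card {i \<in> {1..m}. q x i \<le> real l * \<alpha> / m0h (q x)})" for l
    by (rule measurable_compose[OF card_meas[of l], of "\<lambda>n. l \<le> m \<and> l \<le> n"])
      (simp only: measurable_count_space_eq1 space_count_space Pi_UNIV UNIV_I)
  then show ?thesis
    unfolding k_hat_eq_Max by (rule measurable_Max_nat)
qed

text \<open>Functions and vectors may change together; this serves both to swap vectors that agree
  on \<open>{1..m}\<close> and to replace the functions by extensions to the real line.\<close>

lemma m0_hat_cong:
  assumes "\<And>i. i \<in> {1..m} \<Longrightarrow> g i (q i) = g' i (q' i)"
    and "\<And>i. i \<in> {1..m} \<Longrightarrow> uniform_mean (g i) = uniform_mean (g' i)"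
  shows "m0_hat m g q = m0_hat m g' q'"
proof -
  have "(\<lambda>i. uniform_mean (g i)) ` {1..m} = (\<lambda>i. uniform_mean (g' i)) ` {1..m}"
    using assms by (intro image_cong) auto
  moreover have "(\<Sum>i=1..m. g i (q i) / uniform_mean (g i)) = (\<Sum>i=1..m. g' i (q' i) / uniform_mean (g' i))"
    by (rule sum.cong[OF refl]) (simp only: assms)
  ultimately show ?thesis unfolding m0_hat_def by (simp only:)
qed

section \<open>Estimators built from monotone functions on the real line\<close>

text \<open>One distribution is fixed, with \<open>T\<close> in the role of its true nulls. The
  functions are monotone on the whole line, which makes them Borel measurable; the extension from
  the unit interval is carried out at the end.\<close>

locale monotone_estimator = prob_space P for P :: "'x measure" +
  fixes m :: nat and p :: "nat \<Rightarrow> 'x \<Rightarrow> real" and g :: "nat \<Rightarrow> real \<Rightarrow> real" and T :: "nat set"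
  assumes m_ge_1: "1 \<le> m"
    and pval_measurable: "\<And>i. i \<in> {1..m} \<Longrightarrow> p i \<in> borel_measurable P"
    and pval_range: "\<And>i x. i \<in> {1..m} \<Longrightarrow> x \<in> space P \<Longrightarrow> p i x \<in> {0..1}"
    and indep_pvals: "indep_vars (\<lambda>_. borel) p {1..m}"
    and T_subset: "T \<subseteq> {1..m}"
    and superuniform: "\<And>i t. i \<in> T \<Longrightarrow> 0 \<le> t \<Longrightarrow> emeasure P {x \<in> space P. p i x \<le> t} \<le> ennreal t"
    and mono_g: "\<And>i. i \<in> {1..m} \<Longrightarrow> mono (g i)"
    and g_range: "\<And>i u. i \<in> {1..m} \<Longrightarrow> g i u \<in> {0..1}"
    and mean_pos: "\<And>i. i \<in> {1..m} \<Longrightarrow> 0 < uniform_mean (g i)"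
begin

definition \<nu> :: real where
  "\<nu> = Min ((\<lambda>i. uniform_mean (g i)) ` {1..m})"

lemma \<nu>_le: "i \<in> {1..m} \<Longrightarrow> \<nu> \<le> uniform_mean (g i)"
  unfolding \<nu>_def by (rule Min_le) auto

lemma \<nu>_pos: "0 < \<nu>"
  unfolding \<nu>_def using m_ge_1 mean_pos by (subst Min_gr_iff) auto

lemma g_measurable: "i \<in> {1..m} \<Longrightarrow> g i \<in> borel_measurable borel"
  by (rule borel_measurable_mono[OF mono_g])

lemma \<nu>_le_1: "\<nu> \<le> 1"
proof -
  interpret U: prob_space uniform01 by (rule prob_space_uniform01)
  have 1: "1 \<in> {1..m}" using m_ge_1 by simp
  have "(\<integral>u. g 1 u \<partial>uniform01) \<le> (\<integral>u. 1 \<partial>uniform01)"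
  proof (rule integral_mono)
    have "g 1 \<in> borel_measurable uniform01"
      unfolding uniform01_eq using g_measurable[OF 1] by (intro measurable_restrict_space1) simp
    then show "integrable uniform01 (g 1)"
      using g_range[OF 1] by (intro U.integrable_const_bound[where B = 1]) auto
  qed (use g_range[OF 1] in auto)
  then show ?thesis
    using \<nu>_le[OF 1] U.prob_space by (simp add: uniform_mean_def)
qed

text \<open>Dropping nonnegative summands lowers the estimate. The empty set gives the lower bound
  \<open>1 / \<nu>\<close>; the true nulls other than \<open>h\<close> give the sum used for the
  inverse moment.\<close>

lemma m0_hat_ge:
  assumes "A \<subseteq> {1..m}"
  shows "1 / \<nu> + (\<Sum>i\<in>A. g i (q i) / uniform_mean (g i)) \<le> m0_hat m g q"
proof -
  have "0 \<le> g i (q i) / uniform_mean (g i)" if "i \<in> {1..m}" for i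
    using g_range[OF that, of "q i"] mean_pos[OF that] by simp
  then show ?thesis
    unfolding m0_hat_def \<nu>_def[symmetric] using assms by (intro add_left_mono sum_mono2) auto
qed

lemma m0_hat_pos: "0 < m0_hat m g q"
proof -
  have "0 < 1 / \<nu>" using \<nu>_pos by simp
  also have "\<dots> \<le> m0_hat m g q" using m0_hat_ge[of "{}" q] by simp
  finally show ?thesis .
qed

lemma m0_hat_mono:
  assumes "\<And>i. i \<in> {1..m} \<Longrightarrow> q i \<le> q' i"
  shows "m0_hat m g q \<le> m0_hat m g q'"
  unfolding m0_hat_def
  by (intro add_left_mono sum_mono divide_right_mono monoD[OF mono_g] assms order_less_imp_le[OF mean_pos])

section \<open>Inverse moment of the estimate, then the false discovery rate\<close>

lemma expectation_inverse_m0_hat_le: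
  assumes "h \<in> T"
  shows "expectation (\<lambda>x. 1 / m0_hat m g ((\<lambda>i. p i x)(h := 0))) \<le> 1 / real (card T)"
proof -
  define I where "I = T - {h}"
  \<comment> \<open>The factor \<open>\<nu>\<close> turns the constant \<open>1 / \<nu>\<close> of
    the estimate into \<open>1\<close>, and \<open>\<nu> \<le> uniform_mean (g i)\<close> keeps
    \<open>Z i x\<close> in the unit interval.\<close>
  define Z where "Z i x = \<nu> * (g i (p i x) / uniform_mean (g i))" for i x
  have I: "I \<subseteq> {1..m}" "finite I" "finite T"
    using T_subset finite_subset[OF T_subset] by (auto simp: I_def)
  \<comment> \<open>The \<open>+ 1\<close> in the inverse moment bound accounts exactly for the
    index \<open>h\<close> missing from \<open>I\<close>.\<close>
  have card_I: "real (card T) = real (card I) + 1"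
    using assms I card_Suc_Diff1[of T h] by (simp add: I_def)
  have Z01: "Z i x \<in> {0..1}" if "i \<in> {1..m}" for i x
  proof -
    have "g i (p i x) * \<nu> \<le> 1 * uniform_mean (g i)"
      using g_range[OF that, of "p i x"] \<nu>_pos \<nu>_le[OF that] by (intro mult_mono) auto
    then show ?thesis
      using g_range[OF that, of "p i x"] mean_pos[OF that] \<nu>_pos by (simp add: Z_def field_simps)
  qed
  have indep_Z: "indep_vars (\<lambda>_. borel) Z I"
    unfolding Z_def
  proof (rule indep_vars_compose2[OF indep_vars_subset[OF indep_pvals I(1)]])
    fix i assume "i \<in> I"
    then have "g i \<in> borel_measurable borel" using I g_measurable by auto
    then show "(\<lambda>u. \<nu> * (g i u / uniform_mean (g i))) \<in> borel_measurable borel" by measurable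
  qed
  moreover have "\<nu> \<le> expectation (Z i)" if "i \<in> I" for i
  proof -
    have i: "i \<in> {1..m}" "i \<in> T" using that I by (auto simp: I_def)
    have "uniform_mean (g i) \<le> expectation (\<lambda>x. g i (p i x))"
      by (rule uniform_mean_le_expectation)
        (use i prob_space_axioms pval_measurable pval_range superuniform mono_g g_range in auto)
    then have "\<nu> * (uniform_mean (g i) / uniform_mean (g i)) \<le> \<nu> * (expectation (\<lambda>x. g i (p i x)) / uniform_mean (g i))"
      using \<nu>_pos mean_pos[OF i(1)] by (intro mult_left_mono divide_right_mono) auto
    moreover have "expectation (Z i) = \<nu> * (expectation (\<lambda>x. g i (p i x)) / uniform_mean (g i))"
      by (simp add: Z_def[abs_def])
    ultimately show ?thesis
      using mean_pos[OF i(1)] by simp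
  qed
  ultimately have "expectation (\<lambda>x. 1 / (1 + (\<Sum>i\<in>I. Z i x))) \<le> 1 / (\<nu> * (real (card I) + 1))"
    using I Z01 \<nu>_pos \<nu>_le_1 by (intro expectation_inverse_one_plus_sum_le) auto
  then have "\<nu> * expectation (\<lambda>x. 1 / (1 + (\<Sum>i\<in>I. Z i x))) \<le> \<nu> * (1 / (\<nu> * (real (card I) + 1)))"
    using \<nu>_pos by (intro mult_left_mono) auto
  moreover have "expectation (\<lambda>x. 1 / m0_hat m g ((\<lambda>i. p i x)(h := 0)))
      \<le> expectation (\<lambda>x. \<nu> * (1 / (1 + (\<Sum>i\<in>I. Z i x))))"
  proof (rule integral_mono_AE')
    have nonneg: "0 \<le> (\<Sum>i\<in>I. Z i x)" for x
      using I Z01 by (intro sum_nonneg) auto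
    have Zm: "Z i \<in> borel_measurable P" if "i \<in> I" for i
      using that indep_Z by (auto simp: indep_vars_def)
    show "integrable P (\<lambda>x. \<nu> * (1 / (1 + (\<Sum>i\<in>I. Z i x))))"
      using nonneg Zm
      by (intro integrable_mult_right integrable_const_bound[where B = 1] AE_I2)
        (auto simp: divide_le_eq_1 intro!: borel_measurable_divide borel_measurable_add borel_measurable_sum)
    have "1 / m0_hat m g ((\<lambda>i. p i x)(h := 0)) \<le> \<nu> * (1 / (1 + (\<Sum>i\<in>I. Z i x)))" for x
    proof -
      have "(1 + (\<Sum>i\<in>I. Z i x)) / \<nu> = 1 / \<nu> + (\<Sum>i\<in>I. g i (p i x) / uniform_mean (g i))"
        using \<nu>_pos unfolding Z_def sum_distrib_left[symmetric] by (simp add: add_divide_distrib)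
      \<comment> \<open>As \<open>h\<close> is not in \<open>I\<close>, setting its p-value to
        \<open>0\<close> leaves this sum unchanged.\<close>
      also have "\<dots> = 1 / \<nu> + (\<Sum>i\<in>I. g i (((\<lambda>i. p i x)(h := 0)) i) / uniform_mean (g i))"
        by (simp add: I_def)
      also have "\<dots> \<le> m0_hat m g ((\<lambda>i. p i x)(h := 0))"
        using I(1) by (rule m0_hat_ge)
      finally have "1 / m0_hat m g ((\<lambda>i. p i x)(h := 0)) \<le> 1 / ((1 + (\<Sum>i\<in>I. Z i x)) / \<nu>)"
        using \<nu>_pos nonneg[of x] by (intro divide_left_mono mult_pos_pos m0_hat_pos) (auto intro: divide_pos_pos)
      then show ?thesis by simp
    qed
    then show "AE x in P. 1 / m0_hat m g ((\<lambda>i. p i x)(h := 0)) \<le> \<nu> * (1 / (1 + (\<Sum>i\<in>I. Z i x)))"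
      by simp
    show "AE x in P. 0 \<le> \<nu> * (1 / (1 + (\<Sum>i\<in>I. Z i x)))"
      using nonneg \<nu>_pos by simp
  qed
  ultimately show ?thesis
    using \<nu>_pos unfolding integral_mult_right_zero by (simp add: card_I)
qed

text \<open>By independence, fixing the other p-values does not affect the law of
  \<open>p h\<close>, so the one-dimensional bound for \<open>u \<le> c * k u\<close> applies to the
  inner integral. Its constant \<open>c\<close> uses the estimate with \<open>p h\<close> replaced
  by \<open>0\<close>, which depends on the other p-values alone.\<close>

lemma nn_integral_rejected_le:
  assumes h: "h \<in> T" and \<alpha>: "0 \<le> \<alpha>"
  shows "(\<integral>\<^sup>+x. ennreal (if h \<in> plugin_BH m \<alpha> (m0_hat m g) (\<lambda>i. p i x)
      then 1 / real (k_hat m \<alpha> (m0_hat m g) (\<lambda>i. p i x)) else 0) \<partial>P)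
    \<le> (\<integral>\<^sup>+x. ennreal (\<alpha> / m0_hat m g ((\<lambda>i. p i x)(h := 0))) \<partial>P)"
proof -
  have hm: "h \<in> {1..m}" using h T_subset by auto
  define J where "J = {1..m} - {h}"
  define W where "W x = restrict (\<lambda>i. p i x) J" for x
  define B where "B = PiM J (\<lambda>_. borel :: real measure)"
  \<comment> \<open>A single p-value is wrapped as a vector indexed by \<open>{h}\<close>, the form
    in which independence of disjoint blocks of coordinates is obtained below.\<close>
  define V where "V x = restrict (\<lambda>i. p i x) {h}" for x
  define B' where "B' = PiM {h} (\<lambda>_. borel :: real measure)"
  define k where "k w u = k_hat m \<alpha> (m0_hat m g) (w(h := u))" for w u
  define c where "c w = \<alpha> / m0_hat m g (w(h := 0))" for w
  define f where "f = (\<lambda>(w, u). ennreal (if u \<le> c w * real (k w u) then 1 / real (k w u) else 0))"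
  \<comment> \<open>Outside \<open>J\<close> the vector \<open>W x\<close> is
    \<open>undefined\<close>; the update repairs coordinate \<open>h\<close>, so agreement holds on
    all of \<open>{1..m}\<close>.\<close>
  have W_eq: "i \<in> {1..m} \<Longrightarrow> ((W x)(h := u)) i = ((\<lambda>i. p i x)(h := u)) i" for x u i
    by (auto simp: W_def J_def)
  have c_W: "c (W x) = \<alpha> / m0_hat m g ((\<lambda>i. p i x)(h := 0))" for x
  proof -
    have "m0_hat m g ((W x)(h := 0)) = m0_hat m g ((\<lambda>i. p i x)(h := 0))"
      by (rule m0_hat_cong) (simp_all only: W_eq)
    then show ?thesis by (simp only: c_def)
  qed
  have k_W: "k (W x) (p h x) = k_hat m \<alpha> (m0_hat m g) (\<lambda>i. p i x)" for x
    unfolding k_def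
  proof (rule k_hat_cong)
    show "m0_hat m g ((W x)(h := p h x)) = m0_hat m g (\<lambda>i. p i x)"
      by (rule m0_hat_cong) (auto simp: W_def J_def)
  qed (auto simp: W_def J_def)
  have c_nonneg: "0 \<le> c w" for w
    unfolding c_def using \<alpha> m0_hat_pos by (intro divide_nonneg_pos) auto
  have "antimono (k w)" for w
    unfolding k_def using \<alpha> by (intro antimonoI k_hat_antimono m0_hat_pos m0_hat_mono) auto

  \<comment> \<open>The function \<open>v\<close> is later the constant \<open>0\<close>, for
    \<open>c\<close>, or \<open>snd\<close>, for \<open>k\<close>.\<close>
  have upd: "(\<lambda>z. (((fst z)(h := v z)) i)) \<in> borel_measurable (B \<Otimes>\<^sub>M borel)"
    if i: "i \<in> {1..m}" and v [measurable]: "v \<in> borel_measurable (B \<Otimes>\<^sub>M borel)" for i and v :: "_ \<Rightarrow> real"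
  proof (cases "i = h")
    case False
    then have "i \<in> J" using i by (simp add: J_def)
    then have "(\<lambda>w. w i) \<in> borel_measurable B"
      unfolding B_def by (rule measurable_component_singleton)
    from measurable_compose[OF measurable_fst this] show ?thesis using False by simp
  qed simp
  note m0_hat_upd = borel_measurable_m0_hat[OF upd g_measurable]
  have "(\<lambda>z. m0_hat m g ((fst z)(h := 0))) \<in> borel_measurable (B \<Otimes>\<^sub>M borel)"
    by (rule m0_hat_upd) auto
  then have [measurable]: "(\<lambda>z. c (fst z)) \<in> borel_measurable (B \<Otimes>\<^sub>M borel)"
    unfolding c_def by measurable
  have [measurable]: "(\<lambda>z. k (fst z) (snd z)) \<in> B \<Otimes>\<^sub>M borel \<rightarrow>\<^sub>M count_space UNIV"
    unfolding k_def by (intro measurable_k_hat m0_hat_upd upd) auto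
  have f_meas [measurable]: "f \<in> borel_measurable (B \<Otimes>\<^sub>M borel)"
    unfolding f_def split_beta' by measurable

  have "indep_var (PiM J (\<lambda>_. borel)) (\<lambda>x. restrict (\<lambda>i. p i x) J)
      (PiM {h} (\<lambda>_. borel)) (\<lambda>x. restrict (\<lambda>i. p i x) {h})"
    using hm by (intro indep_var_restrict[OF indep_pvals]) (auto simp: J_def)
  then have "indep_var B W B' V"
    by (simp only: B_def B'_def W_def[abs_def] V_def[abs_def])
  then have W_meas [measurable]: "W \<in> P \<rightarrow>\<^sub>M B" and V_meas [measurable]: "V \<in> P \<rightarrow>\<^sub>M B'"
    and distr_eq: "distr P B W \<Otimes>\<^sub>M distr P B' V = distr P (B \<Otimes>\<^sub>M B') (\<lambda>x. (W x, V x))"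
    by (auto simp: indep_var_distribution_eq)
  have ph_meas [measurable]: "p h \<in> borel_measurable P"
    using hm by (rule pval_measurable)
  have h_meas [measurable]: "(\<lambda>v. v h) \<in> borel_measurable B'"
    unfolding B'_def by (rule measurable_component_singleton) simp
  interpret V: prob_space "distr P B' V"
    by (rule prob_space_distr) measurable
  interpret ph: prob_space "distr P borel (p h)"
    by (rule prob_space_distr) measurable

  have "(\<integral>\<^sup>+x. ennreal (if h \<in> plugin_BH m \<alpha> (m0_hat m g) (\<lambda>i. p i x)
      then 1 / real (k_hat m \<alpha> (m0_hat m g) (\<lambda>i. p i x)) else 0) \<partial>P) \<le> (\<integral>\<^sup>+x. f (W x, p h x) \<partial>P)"
  proof (rule nn_integral_mono)
    fix x assume x: "x \<in> space P"
    let ?k = "k_hat m \<alpha> (m0_hat m g) (\<lambda>i. p i x)"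
    \<comment> \<open>A rejected p-value lies below the threshold. Since \<open>p h x\<close> is
      nonnegative, replacing it by \<open>0\<close> in the estimate can only lower the estimate and
      raise the threshold.\<close>
    have "p h x \<le> c (W x) * real ?k" if "h \<in> plugin_BH m \<alpha> (m0_hat m g) (\<lambda>i. p i x)"
    proof -
      have "p h x \<le> real ?k * \<alpha> / m0_hat m g (\<lambda>i. p i x)"
        using that plugin_BH_eq[where m0h = "m0_hat m g", OF \<alpha> m0_hat_pos] by auto
      also have "\<dots> \<le> real ?k * \<alpha> / m0_hat m g ((\<lambda>i. p i x)(h := 0))"
        using \<alpha> pval_range[OF _ x]
        by (intro divide_left_mono m0_hat_mono mult_pos_pos m0_hat_pos) auto
      finally show ?thesis by (simp add: c_W mult.commute)
    qed
    then show "ennreal (if h \<in> plugin_BH m \<alpha> (m0_hat m g) (\<lambda>i. p i x) then 1 / real ?k else 0) \<le> f (W x, p h x)"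
      by (auto simp: f_def k_W)
  qed
  also have "\<dots> = (\<integral>\<^sup>+z. f (fst z, snd z h) \<partial>distr P (B \<Otimes>\<^sub>M B') (\<lambda>x. (W x, V x)))"
  proof -
    have "p h x = V x h" for x by (simp add: V_def)
    then show ?thesis by (simp add: nn_integral_distr)
  qed
  \<comment> \<open>Independence makes the joint law a product, so the integral over
    \<open>p h\<close> can be taken first.\<close>
  also have "\<dots> = (\<integral>\<^sup>+w. \<integral>\<^sup>+v. f (w, v h) \<partial>distr P B' V \<partial>distr P B W)"
    unfolding distr_eq[symmetric] by (subst V.nn_integral_fst[symmetric]) auto
  also have "\<dots> \<le> (\<integral>\<^sup>+w. ennreal (c w) \<partial>distr P B W)"
  proof (rule nn_integral_mono)
    fix w assume "w \<in> space (distr P B W)"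
    then have "w \<in> space B" by simp
    then have [measurable]: "(\<lambda>u. f (w, u)) \<in> borel_measurable borel"
      by (intro measurable_Pair2[OF f_meas])
    have "(\<integral>\<^sup>+v. f (w, v h) \<partial>distr P B' V) = (\<integral>\<^sup>+u. f (w, u) \<partial>distr P borel (p h))"
      by (simp add: nn_integral_distr V_def)
    moreover have "(\<integral>\<^sup>+u. f (w, u) \<partial>distr P borel (p h)) \<le> ennreal (c w)"
    proof -
      have "emeasure (distr P borel (p h)) {..t} \<le> ennreal t" if "0 \<le> t" for t
        using superuniform[OF h that]
        by (subst emeasure_distr) (auto simp: vimage_def Int_def conj_commute)
      then show ?thesis
        unfolding f_def prod.case using \<open>antimono (k w)\<close> c_nonneg ph.prob_space_axioms
        by (intro nn_integral_self_consistent_le) auto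
    qed
    ultimately show "(\<integral>\<^sup>+v. f (w, v h) \<partial>distr P B' V) \<le> ennreal (c w)"
      by (simp only:)
  qed
  also have "\<dots> = (\<integral>\<^sup>+x. ennreal (c (W x)) \<partial>P)"
  proof -
    have "(\<lambda>w. (w, 0 :: real)) \<in> B \<rightarrow>\<^sub>M B \<Otimes>\<^sub>M borel" by measurable
    from measurable_compose[OF this, of "\<lambda>z. c (fst z)" borel] have "c \<in> borel_measurable B" by simp
    then show ?thesis by (simp add: nn_integral_distr)
  qed
  finally show ?thesis by (simp add: c_W)
qed

text \<open>The false discovery proportion splits into one term \<open>1 / k\<close> per rejected
  true null. Each true null contributes at most \<open>\<alpha> / card T\<close> in the mean, by the
  bound on the rejected part and the inverse moment bound.\<close>

lemma expectation_FDP_le: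
  assumes \<alpha>: "0 \<le> \<alpha>"
  defines "R \<equiv> plugin_BH m \<alpha> (m0_hat m g)"
  shows "expectation (\<lambda>x. real (card (R (\<lambda>i. p i x) \<inter> T)) / real (max 1 (card (R (\<lambda>i. p i x))))) \<le> \<alpha>"
proof -
  define k where "k x = k_hat m \<alpha> (m0_hat m g) (\<lambda>i. p i x)" for x
  define r where "r h x = (if h \<in> R (\<lambda>i. p i x) then 1 / real (k x) else 0)" for h x
  have "finite T" using T_subset finite_subset by auto
  have m0_hat_meas [measurable]: "(\<lambda>x. m0_hat m g (\<lambda>i. p i x)) \<in> borel_measurable P"
    by (rule borel_measurable_m0_hat[OF pval_measurable g_measurable])
  have k_meas [measurable]: "k \<in> P \<rightarrow>\<^sub>M count_space UNIV"
    unfolding k_def by (rule measurable_k_hat[OF pval_measurable m0_hat_meas])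
  have r_meas [measurable]: "r h \<in> borel_measurable P" if "h \<in> T" for h
  proof -
    have [measurable]: "p h \<in> borel_measurable P" using that T_subset pval_measurable by auto
    have "r h = (\<lambda>x. if p h x \<le> real (k x) * \<alpha> / m0_hat m g (\<lambda>i. p i x) then 1 / real (k x) else 0)"
      using that T_subset by (auto simp: r_def R_def k_def plugin_BH_eq \<alpha> m0_hat_pos fun_eq_iff)
    then show ?thesis by simp
  qed
  have r_nonneg: "0 \<le> r h x" for h x by (simp add: r_def)
  \<comment> \<open>Without rejections both sides are \<open>0\<close>; otherwise the maximum with
    \<open>1\<close> is the number of rejections itself.\<close>
  have split: "real (card (R (\<lambda>i. p i x) \<inter> T)) / real (max 1 (card (R (\<lambda>i. p i x)))) = (\<Sum>h\<in>T. r h x)" for x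
  proof -
    have card_R: "card (R (\<lambda>i. p i x)) = k x" by (simp add: R_def k_def card_plugin_BH)
    have fin: "finite (R (\<lambda>i. p i x))"
      unfolding R_def by (rule finite_subset[OF plugin_BH_subset]) simp
    have "(\<Sum>h\<in>T. r h x) = real (card (R (\<lambda>i. p i x) \<inter> T)) / real (k x)"
      using \<open>finite T\<close> by (simp add: r_def sum.If_cases Int_commute)
    moreover have "R (\<lambda>i. p i x) \<inter> T = {}" if "k x = 0"
      using that card_R fin by auto
    ultimately show ?thesis by (cases "k x = 0") (auto simp: card_R max_def)
  qed
  have "expectation (\<lambda>x. \<Sum>h\<in>T. r h x) \<le> \<alpha>"
  proof -
    have r_le: "(\<integral>\<^sup>+x. ennreal (r h x) \<partial>P) \<le> ennreal (\<alpha> / real (card T))" if "h \<in> T" for h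
    proof -
      have [measurable]: "(\<lambda>x. m0_hat m g ((\<lambda>i. p i x)(h := 0))) \<in> borel_measurable P"
      proof (rule borel_measurable_m0_hat[OF _ g_measurable])
        fix i assume "i \<in> {1..m}"
        then show "(\<lambda>x. ((\<lambda>i. p i x)(h := 0)) i) \<in> borel_measurable P"
          using pval_measurable by (cases "i = h") auto
      qed auto
      \<comment> \<open>Boundedness makes the inverse estimate integrable, so that its nonnegative
        integral can be turned into an expectation.\<close>
      have "1 / m0_hat m g q \<le> \<nu>" for q
        using m0_hat_ge[of "{}" q] m0_hat_pos[of q] \<nu>_pos by (simp add: field_simps)
      then have int: "integrable P (\<lambda>x. 1 / m0_hat m g ((\<lambda>i. p i x)(h := 0)))"
        using m0_hat_pos by (intro integrable_const_bound[where B = \<nu>]) (auto simp: less_imp_le)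
      have "(\<integral>\<^sup>+x. ennreal (r h x) \<partial>P) \<le> (\<integral>\<^sup>+x. ennreal (\<alpha> * (1 / m0_hat m g ((\<lambda>i. p i x)(h := 0)))) \<partial>P)"
        unfolding r_def R_def k_def using nn_integral_rejected_le[OF that \<alpha>] by simp
      also have "\<dots> = ennreal (\<alpha> * expectation (\<lambda>x. 1 / m0_hat m g ((\<lambda>i. p i x)(h := 0))))"
        using \<alpha> int m0_hat_pos
        by (subst nn_integral_eq_integral) (auto simp: less_imp_le simp del: times_divide_eq_right)
      also have "\<dots> \<le> ennreal (\<alpha> * (1 / real (card T)))"
        using \<alpha> expectation_inverse_m0_hat_le[OF that] by (intro ennreal_leI mult_left_mono)
      finally show ?thesis by simp
    qed
    have "(\<integral>\<^sup>+x. ennreal (\<Sum>h\<in>T. r h x) \<partial>P) = (\<Sum>h\<in>T. \<integral>\<^sup>+x. ennreal (r h x) \<partial>P)"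
      using r_nonneg r_meas by (subst nn_integral_sum[symmetric]) auto
    also have "\<dots> \<le> (\<Sum>h\<in>T. ennreal (\<alpha> / real (card T)))"
      using r_le by (rule sum_mono)
    also have "\<dots> = ennreal (\<Sum>h\<in>T. \<alpha> / real (card T))"
      using \<alpha> by (intro sum_ennreal) auto
    \<comment> \<open>The sum is \<open>\<alpha>\<close>, or \<open>0\<close> if \<open>T\<close> is
      empty.\<close>
    also have "\<dots> \<le> ennreal \<alpha>"
      using \<alpha> by (intro ennreal_leI) simp
    finally show ?thesis
      using \<alpha> r_nonneg r_meas
      by (subst integral_eq_nn_integral) (auto intro!: enn2real_leI sum_nonneg)
  qed
  then show ?thesis by (simp only: split)
qed

end

section \<open>The plug-in procedure\<close>

text \<open>The projection onto the unit interval. Composition with it extends a function that is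
  monotone on the unit interval to a monotone function on the real line.\<close>

definition clamp01 :: "real \<Rightarrow> real" where
  "clamp01 u = max 0 (min 1 u)"

lemma clamp01_eq: "u \<in> {0..1} \<Longrightarrow> clamp01 u = u"
  by (simp add: clamp01_def)

theorem proposition2p1:
  fixes M :: "'x measure" and \<P> :: "'x measure set"
    and m :: nat and H :: "nat \<Rightarrow> 'x measure set"
    and p :: "nat \<Rightarrow> 'x \<Rightarrow> real" and g :: "nat \<Rightarrow> real \<Rightarrow> real"
  assumes "m \<ge> 1"
    and "\<And>P. P \<in> \<P> \<Longrightarrow> prob_space P \<and> sets P = sets M"
    and "\<And>i. i \<in> {1..m} \<Longrightarrow> p i \<in> borel_measurable M"
    and "\<And>i x. i \<in> {1..m} \<Longrightarrow> x \<in> space M \<Longrightarrow> p i x \<in> {0..1}"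
    and "\<And>P. P \<in> \<P> \<Longrightarrow> prob_space.indep_vars P (\<lambda>_. borel) p {1..m}"
    and "\<And>i t. i \<in> {1..m} \<Longrightarrow> t \<in> {0..1} \<Longrightarrow> null_cdf \<P> m H p i t \<le> ennreal t"
    and "\<And>i. i \<in> {1..m} \<Longrightarrow> g i \<in> \<G>"
  shows "(\<forall>P\<in>\<P>. \<forall>h\<in>true_nulls m H P.
            (\<integral>x. 1 / m0_hat m g ((\<lambda>i. p i x)(h := 0)) \<partial>P) \<le> 1 / real (card (true_nulls m H P)))
       \<and> (\<forall>\<alpha>\<in>{0<..<1}. controls_FDR \<P> m H p (plugin_BH m \<alpha> (m0_hat m g)) \<alpha>)"
proof -
  define G where "G i u = g i (clamp01 u)" for i u
  \<comment> \<open>The uniform distribution has space \<open>{0..1}\<close>, on which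
    \<open>G i\<close> and \<open>g i\<close> agree.\<close>
  have mean_eq: "uniform_mean (G i) = uniform_mean (g i)" for i
    unfolding uniform_mean_def G_def
    by (rule Bochner_Integration.integral_cong)
      (auto simp: uniform01_eq space_restrict_space clamp01_eq)
  have m0_hat_eq: "m0_hat m g q = m0_hat m G q" if "\<And>i. i \<in> {1..m} \<Longrightarrow> q i \<in> {0..1}" for q
    by (rule m0_hat_cong) (use that in \<open>auto simp: mean_eq G_def clamp01_eq\<close>)
  have clamp01_range: "clamp01 u \<in> {0..1}" for u
    by (simp add: clamp01_def)
  have estimator: "monotone_estimator P m p G (true_nulls m H P)" if P: "P \<in> \<P>" for P
  proof -
    interpret prob_space P using assms(2)[OF P] by simp
    have sets: "sets P = sets M" using assms(2)[OF P] by simp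
    note space = sets_eq_imp_space_eq[OF sets]
    show ?thesis
    proof unfold_locales
      show "p i \<in> borel_measurable P" if "i \<in> {1..m}" for i
        using assms(3)[OF that] measurable_cong_sets[OF sets refl] by blast
      \<comment> \<open>For \<open>t \<le> 1\<close>, \<open>P\<close> is among the distributions of
        the supremum; beyond \<open>1\<close> the bound exceeds every probability.\<close>
      show "emeasure P {x \<in> space P. p i x \<le> t} \<le> ennreal t" if i: "i \<in> true_nulls m H P" and t: "0 \<le> t" for i t
      proof (cases "t \<le> 1")
        case True
        have "emeasure P {x \<in> space P. p i x \<le> t} \<le> null_cdf \<P> m H p i t"
          unfolding null_cdf_def using P i by (intro SUP_upper) auto
        also have "\<dots> \<le> ennreal t"
          using i t True by (intro assms(6)) (auto simp: true_nulls_def)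
        finally show ?thesis .
      next
        case False
        have "emeasure P {x \<in> space P. p i x \<le> t} \<le> 1" by (rule emeasure_le_1)
        also have "\<dots> \<le> ennreal t" using False by simp
        finally show ?thesis .
      qed
      show "mono (G i)" if "i \<in> {1..m}" for i
      proof (rule monoI)
        fix u v :: real assume "u \<le> v"
        then have "clamp01 u \<le> clamp01 v" by (auto simp: clamp01_def)
        then show "G i u \<le> G i v"
          unfolding G_def using assms(7)[OF that] clamp01_range by (auto simp: \<G>_def mono_on_def)
      qed
      show "G i u \<in> {0..1}" if "i \<in> {1..m}" for i u
        unfolding G_def using assms(7)[OF that] clamp01_range unfolding \<G>_def by blast
      show "0 < uniform_mean (G i)" if "i \<in> {1..m}" for i
        using assms(7)[OF that] by (simp add: mean_eq \<G>_def)
    qed (use assms(1,4) assms(5)[OF P] in \<open>auto simp: space true_nulls_def\<close>)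
  qed
  show ?thesis
  proof (intro conjI ballI)
    fix P h assume P: "P \<in> \<P>" and h: "h \<in> true_nulls m H P"
    have space: "space P = space M" using assms(2)[OF P] sets_eq_imp_space_eq by blast
    \<comment> \<open>All p-values lie in the unit interval, and so does the inserted
      \<open>0\<close>; hence \<open>g\<close> and \<open>G\<close> give the same estimate at every
      point of the space.\<close>
    have "(\<integral>x. 1 / m0_hat m g ((\<lambda>i. p i x)(h := 0)) \<partial>P) = (\<integral>x. 1 / m0_hat m G ((\<lambda>i. p i x)(h := 0)) \<partial>P)"
    proof (rule Bochner_Integration.integral_cong)
      fix x assume "x \<in> space P"
      then show "1 / m0_hat m g ((\<lambda>i. p i x)(h := 0)) = 1 / m0_hat m G ((\<lambda>i. p i x)(h := 0))"
        using assms(4) by (subst m0_hat_eq) (auto simp: space)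
    qed simp
    then show "(\<integral>x. 1 / m0_hat m g ((\<lambda>i. p i x)(h := 0)) \<partial>P) \<le> 1 / real (card (true_nulls m H P))"
      using monotone_estimator.expectation_inverse_m0_hat_le[OF estimator[OF P] h] by simp
  next
    fix \<alpha> :: real assume \<alpha>: "\<alpha> \<in> {0<..<1}"
    show "controls_FDR \<P> m H p (plugin_BH m \<alpha> (m0_hat m g)) \<alpha>"
      unfolding controls_FDR_def
    proof
      fix P assume P: "P \<in> \<P>"
      have space: "space P = space M" using assms(2)[OF P] sets_eq_imp_space_eq by blast
      have "plugin_BH m \<alpha> (m0_hat m g) (\<lambda>i. p i x) = plugin_BH m \<alpha> (m0_hat m G) (\<lambda>i. p i x)"
        if "x \<in> space P" for x
        unfolding plugin_BH_def k_hat_def using that assms(4) by (subst m0_hat_eq) (auto simp: space)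
      then have "FDR m H p (plugin_BH m \<alpha> (m0_hat m g)) P = FDR m H p (plugin_BH m \<alpha> (m0_hat m G)) P"
        unfolding FDR_def by (intro Bochner_Integration.integral_cong) auto
      then show "FDR m H p (plugin_BH m \<alpha> (m0_hat m g)) P \<le> \<alpha>"
        unfolding FDR_def using monotone_estimator.expectation_FDP_le[OF estimator[OF P], of \<alpha>] \<alpha> by simp
    qed
  qed
qed

end
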